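(* Let $X$ be a real Banach space. Let $z\in S_X$, $K>0$ and let $\Phi,\Psi:B_X\to X$ be norm one functions. Take a subset $B\subset B_X$. The following statements are equivalent. (1) There is a weak$^*$-compact convex set $V\subset X^*$ such that for all finite sequences $x_1,\dots,x_n\in B$ and positive scalars $\alpha_1,\dots,\alpha_n$ such that $\sum_{i=1}^n\alpha_i=1$ we have $$\sum_{i=1}^n\alpha_i\|\Psi(x_i)-z\|\le K\sup_{x^*\in V}\Bigl(1-\Bigl\langle\sum_{i=1}^n\alpha_i\Phi(x_i),x^*\Bigr\rangle\Bigr).$$ (2) For each $\varepsilon>0$ there exists $x_0^*\in V$ such that $$\|\Psi(x)-z\|\le K(1-\langle\Phi(x),x_0^*\rangle)$$ for all $x\in B_X$. These equivalent properties imply that for each $\varepsilon>0$ there exists $x_0^*\in V$ such that $\Psi(S(x_0^*\circ\Phi,\varepsilon)\cap B)\subset B_{K\varepsilon}(z)$.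
   Context: $B_X$ is the closed unit ball and $S_X$ the unit sphere of $X$; $X^*$ is the dual space. A norm one function $\Phi:B_X\to X$ is a bounded map, not assumed linear, with $\|\Phi\|:=\sup_{x\in B_X}\|\Phi(x)\|=1$. For a scalar-valued function $p$ on $B_X$ and $\varepsilon>0$, the slice is $S(p,\varepsilon)=\{x\in B_X:\operatorname{Re}p(x)\ge 1-\varepsilon\}$, which may be empty. $B_r(z)$ denotes the ball of radius $r$ centred at $z$. The set $V$ in (2) and in the final assertion is the one introduced in (1).
   Formalization: In (2) the inequality is required for all x in B rather than all x in B_X, since the printed (1) ⇒ (2) fails (e.g. B empty, K=1, Φ=id, Ψ=z except Ψ(0)=−z); V is also required to be nonempty. *)

theory Defs
  imports "HOL-Analysis.Analysis"
begin

text \<open>On the dual space (functionals into the reals), the strong operator topology is the topology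
  of pointwise convergence, i.e. the weak-star topology.\<close>

abbreviation weak_star_topology :: "('a::real_normed_vector \<Rightarrow>\<^sub>L real) topology" where
  "weak_star_topology \<equiv> strong_operator_topology"

text \<open>Functions on the closed unit ball are represented by total functions whose values outside
  the ball play no role. Boundedness is explicit because \<^term>\<open>Sup\<close> on the reals is
  unspecified for unbounded sets.\<close>

definition norm_one_map :: "('a::real_normed_vector \<Rightarrow> 'a) \<Rightarrow> bool" where
  "norm_one_map \<Phi> \<longleftrightarrow>
     bdd_above ((\<lambda>x. norm (\<Phi> x)) ` cball 0 1) \<and> (SUP x\<in>cball 0 1. norm (\<Phi> x)) = 1"

definition slice :: "('a::real_normed_vector \<Rightarrow> real) \<Rightarrow> real \<Rightarrow> 'a set" where
  "slice p \<epsilon> = {x \<in> cball 0 1. p x \<ge> 1 - \<epsilon>}"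

text \<open>Nonemptiness is required so that the suprema over \<open>V\<close> are meaningful; with weak-star
  compactness they are then suprema of nonempty bounded sets of reals.\<close>

definition weak_star_compact_convex :: "('a::real_normed_vector \<Rightarrow>\<^sub>L real) set \<Rightarrow> bool" where
  "weak_star_compact_convex V \<longleftrightarrow> V \<noteq> {} \<and> compactin weak_star_topology V \<and> convex V"

text \<open>The case \<open>n = 0\<close> is excluded by the requirement that the weights sum to one.\<close>

definition dominated_on_combinations ::
    "('a::real_normed_vector \<Rightarrow> 'a) \<Rightarrow> ('a \<Rightarrow> 'a) \<Rightarrow> 'a \<Rightarrow> real \<Rightarrow> 'a set \<Rightarrow> ('a \<Rightarrow>\<^sub>L real) set \<Rightarrow> bool" where
  "dominated_on_combinations \<Phi> \<Psi> z K B V \<longleftrightarrow>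
     (\<forall>(n::nat) (x::nat \<Rightarrow> 'a) (\<alpha>::nat \<Rightarrow> real).
        (\<forall>i\<in>{1..n}. x i \<in> B) \<and> (\<forall>i\<in>{1..n}. \<alpha> i > 0) \<and> (\<Sum>i=1..n. \<alpha> i) = 1 \<longrightarrow>
        (\<Sum>i=1..n. \<alpha> i * norm (\<Psi> (x i) - z))
          \<le> K * (SUP f\<in>V. 1 - blinfun_apply f (\<Sum>i=1..n. \<alpha> i *\<^sub>R \<Phi> (x i))))"

text \<open>The inequality is required on the same set \<open>B\<close> as in
  \<^const>\<open>dominated_on_combinations\<close>. If it were required on the whole unit ball,
  the equivalence of the two conditions would fail for general \<open>B\<close>, e.g. \<open>B = {}\<close>. The variable
  \<open>\<epsilon>\<close> does not occur in the inequality.\<close>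

definition dominated_by_functional ::
    "('a::real_normed_vector \<Rightarrow> 'a) \<Rightarrow> ('a \<Rightarrow> 'a) \<Rightarrow> 'a \<Rightarrow> real \<Rightarrow> 'a set \<Rightarrow> ('a \<Rightarrow>\<^sub>L real) set \<Rightarrow> bool" where
  "dominated_by_functional \<Phi> \<Psi> z K B V \<longleftrightarrow>
     (\<forall>\<epsilon>::real. \<epsilon> > 0 \<longrightarrow>
        (\<exists>f\<in>V. \<forall>x\<in>B. norm (\<Psi> x - z) \<le> K * (1 - blinfun_apply f (\<Phi> x))))"

end

theory Submission
  imports Defs
begin

text \<open>For each \<open>x \<in> B\<close> the function \<open>g x f = K * (1 - f (\<Phi> x)) - norm (\<Psi> x - z)\<close> is affine and
  weak-star continuous in \<open>f\<close>. Since suprema over \<open>V\<close> are attained, condition (1) says that every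
  convex combination of the \<open>g x\<close> is nonnegative somewhere on \<open>V\<close>, and (2) says that all \<open>g x\<close>
  are nonnegative at a common point of \<open>V\<close>. So (1) implies (2) by a theorem of the alternative for
  concave functions on compact convex sets. For two functions it is a separation argument in the
  plane; finitely many are reduced to two by induction, shrinking \<open>V\<close> to the set where the new
  function is nonnegative; and compactness handles the infinite case.\<close>

section \<open>A theorem of the alternative for concave functions on compact convex sets\<close>

text \<open>If no common point exists, the origin can be strictly separated from the set of pairs
  lying below some \<open>(g v, h v)\<close>. The separating normal, after a change of sign and
  normalisation, provides weights that contradict \<open>comb\<close>.\<close>

lemma concave_pair_nonneg:
  fixes g h :: "'v::real_vector \<Rightarrow> real"
  assumes V: "compactin T V" "V \<noteq> {}"
    and g: "concave_on V g" "continuous_map T euclideanreal g"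
    and h: "concave_on V h" "continuous_map T euclideanreal h"
    and comb: "\<And>s t. \<lbrakk>0 \<le> s; 0 \<le> t; s + t = 1\<rbrakk> \<Longrightarrow> \<exists>v\<in>V. 0 \<le> s * g v + t * h v"
  shows "\<exists>v\<in>V. 0 \<le> g v \<and> 0 \<le> h v"
proof (rule ccontr)
  assume none: "\<not> ?thesis"
  \<comment> \<open>The image of \<open>V\<close> need not be convex, since \<open>g\<close> and
    \<open>h\<close> are only concave. Adding the quadrant of nonpositive pairs makes it convex, and
    it stays closed as the sum of a compact and a closed set.\<close>
  define D where "D = (\<Union>x\<in>(\<lambda>v. (g v, h v)) ` V. \<Union>y\<in>{..0} \<times> {..0}. {x + y})"
  have D_iff: "p \<in> D \<longleftrightarrow> (\<exists>v\<in>V. fst p \<le> g v \<and> snd p \<le> h v)" for p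
  proof
    assume "\<exists>v\<in>V. fst p \<le> g v \<and> snd p \<le> h v"
    then obtain v where v: "v \<in> V" "fst p \<le> g v" "snd p \<le> h v"
      by blast
    then show "p \<in> D"
      unfolding D_def
      by (intro UN_I[of "(g v, h v)"] UN_I[of "(fst p - g v, snd p - h v)"])
        (auto simp: prod_eq_iff)
  qed (force simp: D_def)
  have "continuous_map T euclidean (\<lambda>v. (g v, h v))"
    using continuous_map_pairedI[OF g(2) h(2)] by simp
  then have "compact ((\<lambda>v. (g v, h v)) ` V)"
    using image_compactin[OF V(1)] by fastforce
  then have "closed D"
    unfolding D_def by (intro compact_closed_sums closed_Times) auto
  moreover have "convex D"
  proof (rule convexI)
    fix p q and s t :: real
    assume "p \<in> D" "q \<in> D" and st: "0 \<le> s" "0 \<le> t" "s + t = 1"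
    then obtain v w where v: "v \<in> V" "fst p \<le> g v" "snd p \<le> h v"
      and w: "w \<in> V" "fst q \<le> g w" "snd q \<le> h w"
      by (auto simp: D_iff)
    have "s *\<^sub>R v + t *\<^sub>R w \<in> V"
      using concave_on_imp_convex[OF g(1)] v w st by (auto simp: convex_def)
    moreover have "s * fst p + t * fst q \<le> s * g v + t * g w"
      "s * snd p + t * snd q \<le> s * h v + t * h w"
      using v w st by (auto intro!: add_mono mult_left_mono)
    moreover have "s * g v + t * g w \<le> g (s *\<^sub>R v + t *\<^sub>R w)"
      "s * h v + t * h w \<le> h (s *\<^sub>R v + t *\<^sub>R w)"
      using g(1) h(1) v w st by (auto simp: concave_on_iff)
    ultimately show "s *\<^sub>R p + t *\<^sub>R q \<in> D"
      unfolding D_iff by (intro bexI[of _ "s *\<^sub>R v + t *\<^sub>R w"]) auto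
  qed
  moreover have "0 \<notin> D"
    using none by (auto simp: D_iff)
  ultimately obtain a b where ab: "a \<noteq> 0" "0 < b" "\<forall>x\<in>D. b < inner a x"
    using separating_hyperplane_closed_0[of D] by blast
  have pos: "0 < fst a * x + snd a * y" if "v \<in> V" "x \<le> g v" "y \<le> h v" for v x y
  proof -
    have "(x, y) \<in> D"
      using that by (auto simp: D_iff)
    with ab(2,3) have "0 < inner a (x, y)"
      by fastforce
    then show ?thesis
      by (simp add: inner_prod_def)
  qed
  obtain v where v: "v \<in> V"
    using V(2) by blast
  \<comment> \<open>If \<open>fst a\<close> were positive, lowering the first coordinate by
    \<open>\<bar>c\<bar> / fst a\<close> would stay inside \<open>D\<close> and bring the inner
    product with \<open>a\<close> down to \<open>c - \<bar>c\<bar> \<le> 0\<close>, against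
    \<open>pos\<close>. The second coordinate is treated alike.\<close>
  define c where "c = fst a * g v + snd a * h v"
  have "fst a \<le> 0"
  proof (rule ccontr)
    assume "\<not> fst a \<le> 0"
    then show False
      using pos[OF v, of "g v - \<bar>c\<bar> / fst a" "h v"]
      by (simp add: right_diff_distrib c_def)
  qed
  have "snd a \<le> 0"
  proof (rule ccontr)
    assume "\<not> snd a \<le> 0"
    then show False
      using pos[OF v, of "g v" "h v - \<bar>c\<bar> / snd a"]
      by (simp add: right_diff_distrib c_def)
  qed
  \<comment> \<open>Both coordinates of \<open>a\<close> are nonpositive and not both vanish, so
    dividing \<open>- a\<close> by \<open>d\<close> turns it into convex weights.\<close>
  define d where "d = - fst a - snd a"
  have "d > 0"
    using ab(1) \<open>fst a \<le> 0\<close> \<open>snd a \<le> 0\<close> by (auto simp: d_def prod_eq_iff)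
  have "0 \<le> - fst a / d" "0 \<le> - snd a / d"
    using \<open>d > 0\<close> \<open>fst a \<le> 0\<close> \<open>snd a \<le> 0\<close> by (auto simp: divide_le_0_iff)
  moreover have "- fst a / d + - snd a / d = 1"
  proof -
    have "- fst a / d + - snd a / d = (- fst a + - snd a) / d"
      by (rule add_divide_distrib[symmetric])
    also have "- fst a + - snd a = d"
      by (simp add: d_def)
    finally show ?thesis
      using \<open>d > 0\<close> by simp
  qed
  ultimately obtain w where w: "w \<in> V" "0 \<le> - fst a / d * g w + - snd a / d * h w"
    using comb by blast
  have "- fst a / d * g w + - snd a / d * h w = - (fst a * g w + snd a * h w) / d"
    by (simp add: add_divide_distrib diff_divide_distrib)
  also have "\<dots> < 0"
    using pos[OF w(1), of "g w" "h w"] \<open>d > 0\<close> by (intro divide_neg_pos) simp_all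
  finally show False
    using w(2) by linarith
qed

lemma concave_on_sum_functions:
  assumes "convex V" "\<And>i. i \<in> I \<Longrightarrow> concave_on V (f i)"
  shows "concave_on V (\<lambda>v. \<Sum>i\<in>I. f i v)"
  using assms(2)
  by (induction I rule: infinite_finite_induct)
    (auto simp: concave_on_const assms(1) intro: concave_on_add)

text \<open>Induction with \<open>V\<close> arbitrary: the superlevel set \<open>W\<close> of the
  new function is again compact and convex, and the case of two functions transfers
  \<open>comb\<close> from \<open>V\<close> to \<open>W\<close>.\<close>

lemma concave_finite_family_nonneg:
  fixes f :: "'i \<Rightarrow> 'v::real_vector \<Rightarrow> real"
  assumes "finite I" and V: "compactin T V" "convex V" "V \<noteq> {}"
    and conc: "\<And>i. i \<in> I \<Longrightarrow> concave_on V (f i)"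
    and cont: "\<And>i. i \<in> I \<Longrightarrow> continuous_map T euclideanreal (f i)"
    and comb: "\<And>\<alpha>. \<lbrakk>\<And>i. i \<in> I \<Longrightarrow> 0 \<le> \<alpha> i; sum \<alpha> I = 1\<rbrakk> \<Longrightarrow> \<exists>v\<in>V. 0 \<le> (\<Sum>i\<in>I. \<alpha> i * f i v)"
  shows "\<exists>v\<in>V. \<forall>i\<in>I. 0 \<le> f i v"
  using assms
proof (induction I arbitrary: V rule: finite_induct)
  case empty
  then show ?case by auto
next
  case (insert j I V)
  \<comment> \<open>Weights on \<open>insert j I\<close> are built by prescribing a separate value
    at \<open>j\<close>; as \<open>j\<close> lies outside \<open>I\<close>, this value is invisible
    to sums over \<open>I\<close>.\<close>
  have drop_j: "(\<Sum>i\<in>I. (if i = j then s else b i) * c i) = (\<Sum>i\<in>I. b i * c i)"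
    "(\<Sum>i\<in>I. if i = j then s else b i) = (\<Sum>i\<in>I. b i)" for s :: real and b c
    using insert.hyps by (auto intro!: sum.cong)
  define W where "W = {v \<in> V. 0 \<le> f j v}"
  have W_eq: "W = {v \<in> topspace T. f j v \<in> {0..}} \<inter> V"
    using compactin_subset_topspace[OF insert.prems(1)] by (auto simp: W_def)
  have "compactin T W"
    unfolding W_eq using insert.prems(1,5)
    by (intro closed_Int_compactin closedin_continuous_map_preimage) auto
  moreover have "convex W"
    unfolding convex_def
  proof (intro ballI allI impI)
    fix x y and s t :: real
    assume xy: "x \<in> W" "y \<in> W" and st: "0 \<le> s" "0 \<le> t" "s + t = 1"
    have "0 \<le> s * f j x + t * f j y"
      using xy st by (simp add: W_def)
    also have "\<dots> \<le> f j (s *\<^sub>R x + t *\<^sub>R y)"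
      using insert.prems(4)[of j] xy st by (simp add: W_def concave_on_iff)
    finally show "s *\<^sub>R x + t *\<^sub>R y \<in> W"
      using insert.prems(2) xy st by (auto simp: W_def convex_def)
  qed
  \<comment> \<open>All the weight sits on \<open>j\<close>.\<close>
  moreover have "\<exists>v\<in>V. 0 \<le> (\<Sum>i\<in>insert j I. (if i = j then 1 else 0) * f i v)"
    using insert.hyps by (intro insert.prems(6)) (auto simp: drop_j)
  then have "W \<noteq> {}"
    using insert.hyps by (auto simp: W_def drop_j)
  moreover have "\<exists>v\<in>W. 0 \<le> (\<Sum>i\<in>I. \<alpha> i * f i v)"
    if \<alpha>: "\<And>i. i \<in> I \<Longrightarrow> 0 \<le> \<alpha> i" "sum \<alpha> I = 1" for \<alpha>
  proof -
    \<comment> \<open>A mixture of \<open>f j\<close> with a convex combination over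
      \<open>I\<close> is a convex combination over \<open>insert j I\<close>, so
      \<open>comb\<close> on \<open>V\<close> supplies what the case of two functions asks
      for.\<close>
    have "\<exists>v\<in>V. 0 \<le> f j v \<and> 0 \<le> (\<Sum>i\<in>I. \<alpha> i * f i v)"
    proof (rule concave_pair_nonneg[OF insert.prems(1,3)])
      show "concave_on V (\<lambda>v. \<Sum>i\<in>I. \<alpha> i * f i v)"
        using insert.prems(2,4) \<alpha>(1) by (intro concave_on_sum_functions concave_on_cmul) auto
      show "continuous_map T euclideanreal (\<lambda>v. \<Sum>i\<in>I. \<alpha> i * f i v)"
        using insert.prems(5) insert.hyps(1)
        by (intro continuous_map_sum continuous_map_real_mult_left) auto
      fix s t :: real
      assume st: "0 \<le> s" "0 \<le> t" "s + t = 1"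
      show "\<exists>v\<in>V. 0 \<le> s * f j v + t * (\<Sum>i\<in>I. \<alpha> i * f i v)"
      proof -
        have "\<exists>v\<in>V. 0 \<le> (\<Sum>i\<in>insert j I. (if i = j then s else t * \<alpha> i) * f i v)"
          using insert.hyps st \<alpha>
          by (intro insert.prems(6)) (auto simp: drop_j simp flip: sum_distrib_left)
        then show ?thesis
          using insert.hyps by (simp add: drop_j mult.assoc sum_distrib_left)
      qed
    qed (use insert.prems in auto)
    then show ?thesis
      by (auto simp: W_def)
  qed
  moreover have "concave_on W (f i)" if "i \<in> I" for i
    using insert.prems(4)[of i] that \<open>convex W\<close>
    by (auto simp: concave_on_def W_def intro: convex_on_subset)
  ultimately have "\<exists>v\<in>W. \<forall>i\<in>I. 0 \<le> f i v"
    using insert.prems(5) by (intro insert.IH) auto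
  then show ?case
    by (auto simp: W_def)
qed

text \<open>The finite intersection property of \<open>V\<close>, applied to the closed sets where
  the single functions are nonnegative, reduces this to finite subfamilies.\<close>

lemma concave_family_nonneg:
  fixes f :: "'i \<Rightarrow> 'v::real_vector \<Rightarrow> real"
  assumes V: "compactin T V" "convex V" "V \<noteq> {}"
    and conc: "\<And>i. i \<in> I \<Longrightarrow> concave_on V (f i)"
    and cont: "\<And>i. i \<in> I \<Longrightarrow> continuous_map T euclideanreal (f i)"
    and comb: "\<And>J \<alpha>. \<lbrakk>finite J; J \<subseteq> I; \<And>i. i \<in> J \<Longrightarrow> 0 < \<alpha> i; sum \<alpha> J = 1\<rbrakk>
      \<Longrightarrow> \<exists>v\<in>V. 0 \<le> (\<Sum>i\<in>J. \<alpha> i * f i v)"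
  shows "\<exists>v\<in>V. \<forall>i\<in>I. 0 \<le> f i v"
proof -
  define C where "C i = {v \<in> topspace T. f i v \<in> {0..}}" for i
  have "closedin T (C i)" if "i \<in> I" for i
    unfolding C_def using cont[OF that] by (intro closedin_continuous_map_preimage) auto
  moreover have "V \<inter> \<Inter>(C ` J) \<noteq> {}" if J: "finite J" "J \<subseteq> I" for J
  proof -
    have "\<exists>v\<in>V. 0 \<le> (\<Sum>i\<in>J. \<alpha> i * f i v)"
      if \<alpha>: "\<And>i. i \<in> J \<Longrightarrow> 0 \<le> \<alpha> i" "sum \<alpha> J = 1" for \<alpha>
    proof -
      \<comment> \<open>Here \<open>comb\<close> covers strictly positive weights only, whereas the
        finite case allows zeros; restricting to the support of \<open>\<alpha>\<close> bridges the
        gap.\<close>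
      define P where "P = {i \<in> J. 0 < \<alpha> i}"
      have P: "finite P" "P \<subseteq> J" "\<forall>i\<in>J - P. \<alpha> i = 0"
        using J \<alpha>(1) by (auto simp: P_def not_less intro: antisym)
      have "sum \<alpha> P = 1"
        using sum.mono_neutral_left[OF J(1) P(2,3)] \<alpha>(2) by simp
      then have "\<exists>v\<in>V. 0 \<le> (\<Sum>i\<in>P. \<alpha> i * f i v)"
        using P(1,2) J(2) by (intro comb) (auto simp: P_def)
      moreover have "(\<Sum>i\<in>P. \<alpha> i * f i v) = (\<Sum>i\<in>J. \<alpha> i * f i v)" for v
        using P J by (intro sum.mono_neutral_left) auto
      ultimately show ?thesis
        by simp
    qed
    then have "\<exists>v\<in>V. \<forall>i\<in>J. 0 \<le> f i v"
      using J V conc cont by (intro concave_finite_family_nonneg) auto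
    then show ?thesis
      using compactin_subset_topspace[OF V(1)] by (fastforce simp: C_def)
  qed
  then have "V \<inter> \<Inter>\<F> \<noteq> {}" if "finite \<F>" "\<F> \<subseteq> C ` I" for \<F>
    using finite_subset_image[OF that] by metis
  ultimately have "V \<inter> \<Inter>(C ` I) \<noteq> {}"
    using V(1) unfolding compactin_fip by blast
  then show ?thesis
    by (auto simp: C_def)
qed

section \<open>Suprema over \<open>V\<close> and convex combinations\<close>

text \<open>Evaluation at a point is weak-star continuous. Compactness of the values makes the
  supremum over \<open>V\<close> attained in one implication and bounded in the other.\<close>

lemma compact_weak_star_eval:
  fixes V :: "('a::real_normed_vector \<Rightarrow>\<^sub>L real) set"
  assumes "compactin weak_star_topology V"
  shows "compact ((\<lambda>f. 1 - blinfun_apply f x) ` V)"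
proof -
  have "continuous_map weak_star_topology euclideanreal (\<lambda>f. 1 - blinfun_apply f x)"
    by (intro continuous_map_diff strong_operator_topology_continuous_evaluation) auto
  then show ?thesis
    using image_compactin[OF assms] by fastforce
qed

lemma convex_combination_eval:
  fixes f :: "'a::real_normed_vector \<Rightarrow>\<^sub>L real"
  assumes "sum \<alpha> J = 1"
  shows "(\<Sum>i\<in>J. \<alpha> i * (K * (1 - blinfun_apply f (y i))))
    = K * (1 - blinfun_apply f (\<Sum>i\<in>J. \<alpha> i *\<^sub>R y i))"
proof -
  have "1 - blinfun_apply f (\<Sum>i\<in>J. \<alpha> i *\<^sub>R y i) = (\<Sum>i\<in>J. \<alpha> i * (1 - blinfun_apply f (y i)))"
    by (simp add: blinfun.sum_right blinfun.scaleR_right right_diff_distrib sum_subtractf assms)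
  then show ?thesis
    by (simp add: sum_distrib_left mult.left_commute)
qed

text \<open>Passes from finite sequences to finite subsets of \<open>B\<close> by enumerating
  \<open>J\<close>, because the theorem of the alternative is applied to a family indexed by the
  points of \<open>B\<close>.\<close>

lemma dominated_on_combinationsD:
  assumes dom: "dominated_on_combinations \<Phi> \<Psi> z K B V"
    and J: "finite J" "J \<subseteq> B" "\<And>x. x \<in> J \<Longrightarrow> 0 < \<alpha> x" "sum \<alpha> J = 1"
  shows "(\<Sum>x\<in>J. \<alpha> x * norm (\<Psi> x - z))
    \<le> K * (SUP f\<in>V. 1 - blinfun_apply f (\<Sum>x\<in>J. \<alpha> x *\<^sub>R \<Phi> x))"
proof -
  obtain e where e: "bij_betw e {1..card J} J"
    using ex_bij_betw_nat_finite_1[OF J(1)] by blast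
  have "e i \<in> J" if "i \<in> {1..card J}" for i
    using e that by (auto simp: bij_betw_def)
  moreover have "(\<Sum>i=1..card J. \<alpha> (e i)) = 1"
    using sum.reindex_bij_betw[OF e, of \<alpha>] J(4) by simp
  ultimately have "(\<Sum>i=1..card J. \<alpha> (e i) * norm (\<Psi> (e i) - z))
    \<le> K * (SUP f\<in>V. 1 - blinfun_apply f (\<Sum>i=1..card J. \<alpha> (e i) *\<^sub>R \<Phi> (e i)))"
    using dom[unfolded dominated_on_combinations_def, rule_format, of "card J" e "\<alpha> \<circ> e"] J(2,3)
    by (auto simp: subset_iff)
  then show ?thesis
    by (simp only: sum.reindex_bij_betw[OF e, of "\<lambda>x. \<alpha> x * norm (\<Psi> x - z)"]
        sum.reindex_bij_betw[OF e, of "\<lambda>x. \<alpha> x *\<^sub>R \<Phi> x"])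
qed

section \<open>The two implications for a fixed \<open>V\<close>\<close>

lemma dominated_on_combinations_imp_functional:
  assumes V: "weak_star_compact_convex V" and "K > 0"
    and dom: "dominated_on_combinations \<Phi> \<Psi> z K B V"
  shows "\<exists>f\<in>V. \<forall>x\<in>B. norm (\<Psi> x - z) \<le> K * (1 - blinfun_apply f (\<Phi> x))"
proof -
  define g where "g x f = K * (1 - blinfun_apply f (\<Phi> x)) - norm (\<Psi> x - z)" for x f
  have V': "V \<noteq> {}" "compactin weak_star_topology V" "convex V"
    using V by (auto simp: weak_star_compact_convex_def)
  have "\<exists>f\<in>V. \<forall>x\<in>B. 0 \<le> g x f"
  proof (rule concave_family_nonneg[OF V'(2,3,1)])
    fix x
    show "concave_on V (g x)"
      unfolding concave_on_iff
    proof (intro conjI ballI allI impI V')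
      fix f h and s t :: real
      assume "s + t = 1"
      then have s: "s = 1 - t"
        by simp
      \<comment> \<open>Equality holds, as \<open>g x\<close> is affine; the weights summing to 1
        preserve its constant part.\<close>
      show "s * g x f + t * g x h \<le> g x (s *\<^sub>R f + t *\<^sub>R h)"
        by (simp add: s g_def blinfun.bilinear_simps algebra_simps)
    qed
    show "continuous_map weak_star_topology euclideanreal (g x)"
      unfolding g_def
      by (intro continuous_map_diff continuous_map_real_mult_left
          strong_operator_topology_continuous_evaluation) auto
  next
    fix J \<alpha>
    assume J: "finite J" "J \<subseteq> B" "\<And>x. x \<in> J \<Longrightarrow> 0 < \<alpha> x" "sum \<alpha> J = (1::real)"
    define w where "w = (\<Sum>x\<in>J. \<alpha> x *\<^sub>R \<Phi> x)"
    \<comment> \<open>This maximiser depends on \<open>J\<close> and \<open>\<alpha>\<close>; the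
      theorem of the alternative then yields one functional for all points of
      \<open>B\<close>.\<close>
    obtain f where f: "f \<in> V" "\<And>h. h \<in> V \<Longrightarrow> 1 - blinfun_apply h w \<le> 1 - blinfun_apply f w"
      using compact_attains_sup[OF compact_weak_star_eval[OF V'(2), of w]] V'(1) by auto
    have "(SUP h\<in>V. 1 - blinfun_apply h w) \<le> 1 - blinfun_apply f w"
      using V'(1) f(2) by (rule cSUP_least)
    then have "(\<Sum>x\<in>J. \<alpha> x * norm (\<Psi> x - z)) \<le> K * (1 - blinfun_apply f w)"
      using dominated_on_combinationsD[OF dom J, folded w_def] \<open>K > 0\<close>
      by (meson mult_left_mono less_imp_le order_trans)
    also have "\<dots> = (\<Sum>x\<in>J. \<alpha> x * (K * (1 - blinfun_apply f (\<Phi> x))))"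
      by (simp add: w_def convex_combination_eval[OF J(4)])
    finally have "0 \<le> (\<Sum>x\<in>J. \<alpha> x * g x f)"
      by (simp add: g_def right_diff_distrib sum_subtractf)
    with f(1) show "\<exists>f\<in>V. 0 \<le> (\<Sum>x\<in>J. \<alpha> x * g x f)"
      by blast
  qed
  then show ?thesis
    by (simp add: g_def)
qed

text \<open>Averaging the pointwise inequalities gives the bound at the single functional
  \<open>f\<close>, which the supremum over \<open>V\<close> can only enlarge.\<close>

lemma dominated_by_functional_imp_combinations:
  assumes V: "weak_star_compact_convex V" and "K > 0"
    and f: "f \<in> V" "\<And>x. x \<in> B \<Longrightarrow> norm (\<Psi> x - z) \<le> K * (1 - blinfun_apply f (\<Phi> x))"
  shows "dominated_on_combinations \<Phi> \<Psi> z K B V"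
  unfolding dominated_on_combinations_def
proof (intro allI impI, elim conjE)
  fix n :: nat and x :: "nat \<Rightarrow> 'a" and \<alpha> :: "nat \<Rightarrow> real"
  assume x: "\<forall>i\<in>{1..n}. x i \<in> B" and \<alpha>: "\<forall>i\<in>{1..n}. \<alpha> i > 0" "(\<Sum>i=1..n. \<alpha> i) = 1"
  define w where "w = (\<Sum>i=1..n. \<alpha> i *\<^sub>R \<Phi> (x i))"
  have "(\<Sum>i=1..n. \<alpha> i * norm (\<Psi> (x i) - z))
      \<le> (\<Sum>i=1..n. \<alpha> i * (K * (1 - blinfun_apply f (\<Phi> (x i)))))"
    using x \<alpha>(1) f(2) by (intro sum_mono mult_left_mono) (simp_all add: order.strict_implies_order)
  also have "\<dots> = K * (1 - blinfun_apply f w)"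
    unfolding w_def by (rule convex_combination_eval[OF \<alpha>(2)])
  also have "\<dots> \<le> K * (SUP f\<in>V. 1 - blinfun_apply f w)"
  proof (intro mult_left_mono cSUP_upper f(1))
    show "bdd_above ((\<lambda>f. 1 - blinfun_apply f w) ` V)"
      using V compact_weak_star_eval[of V w]
      by (intro bounded_imp_bdd_above compact_imp_bounded) (simp add: weak_star_compact_convex_def)
  qed (use \<open>K > 0\<close> in simp)
  finally show "(\<Sum>i=1..n. \<alpha> i * norm (\<Psi> (x i) - z))
      \<le> K * (SUP f\<in>V. 1 - blinfun_apply f (\<Sum>i=1..n. \<alpha> i *\<^sub>R \<Phi> (x i)))"
    by (simp add: w_def)
qed

theorem proposition5p9:
  fixes z :: "'a::banach" and K :: real and \<Phi> \<Psi> :: "'a \<Rightarrow> 'a" and B :: "'a set"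
  assumes "z \<in> sphere 0 1" and "K > 0"
    and "norm_one_map \<Phi>" and "norm_one_map \<Psi>"
    and "B \<subseteq> cball 0 1"
  shows "((\<exists>V. weak_star_compact_convex V \<and> dominated_on_combinations \<Phi> \<Psi> z K B V) \<longleftrightarrow>
          (\<exists>V. weak_star_compact_convex V \<and> dominated_by_functional \<Phi> \<Psi> z K B V)) \<and>
         (\<forall>V. weak_star_compact_convex V \<longrightarrow>
            (dominated_on_combinations \<Phi> \<Psi> z K B V \<longleftrightarrow> dominated_by_functional \<Phi> \<Psi> z K B V) \<and>
            (dominated_on_combinations \<Phi> \<Psi> z K B V \<longrightarrow>
               (\<forall>\<epsilon>::real. \<epsilon> > 0 \<longrightarrow>
                  (\<exists>f\<in>V. \<Psi> ` (slice (blinfun_apply f \<circ> \<Phi>) \<epsilon> \<inter> B) \<subseteq> cball z (K * \<epsilon>)))))"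
proof -
  \<comment> \<open>The inequality is independent of \<open>\<epsilon>\<close>, so the instance 1
    already gives the functional.\<close>
  have functional_iff: "dominated_by_functional \<Phi> \<Psi> z K B V \<longleftrightarrow>
      (\<exists>f\<in>V. \<forall>x\<in>B. norm (\<Psi> x - z) \<le> K * (1 - blinfun_apply f (\<Phi> x)))" for V
    unfolding dominated_by_functional_def using zero_less_one by blast
  have equiv: "dominated_on_combinations \<Phi> \<Psi> z K B V \<longleftrightarrow> dominated_by_functional \<Phi> \<Psi> z K B V"
    if "weak_star_compact_convex V" for V
    using dominated_on_combinations_imp_functional[OF that \<open>K > 0\<close>]
      dominated_by_functional_imp_combinations[OF that \<open>K > 0\<close>]
    unfolding functional_iff by blast
  \<comment> \<open>Membership in the slice bounds \<open>1 - f (\<Phi> x)\<close> by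
    \<open>\<epsilon>\<close>, so the same \<open>f\<close> serves every
    \<open>\<epsilon>\<close>.\<close>
  have slice: "\<Psi> ` (slice (blinfun_apply f \<circ> \<Phi>) \<epsilon> \<inter> B) \<subseteq> cball z (K * \<epsilon>)"
    if f: "\<forall>x\<in>B. norm (\<Psi> x - z) \<le> K * (1 - blinfun_apply f (\<Phi> x))" for f \<epsilon>
  proof clarify
    fix x
    assume "x \<in> slice (blinfun_apply f \<circ> \<Phi>) \<epsilon>" "x \<in> B"
    then have "norm (\<Psi> x - z) \<le> K * (1 - blinfun_apply f (\<Phi> x))" "1 - blinfun_apply f (\<Phi> x) \<le> \<epsilon>"
      using f by (auto simp: slice_def)
    then have "norm (\<Psi> x - z) \<le> K * \<epsilon>"
      using \<open>K > 0\<close> by (meson mult_left_mono less_imp_le order_trans)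
    then show "\<Psi> x \<in> cball z (K * \<epsilon>)"
      by (simp add: dist_norm norm_minus_commute)
  qed
  have "\<exists>f\<in>V. \<Psi> ` (slice (blinfun_apply f \<circ> \<Phi>) \<epsilon> \<inter> B) \<subseteq> cball z (K * \<epsilon>)"
    if "weak_star_compact_convex V" "dominated_on_combinations \<Phi> \<Psi> z K B V" for V \<epsilon>
    using equiv[OF that(1)] that(2) slice unfolding functional_iff by blast
  with equiv show ?thesis
    by blast
qed

end
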